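(* Let $f:\mathbb{R}^n\to\mathbb{R}$ be $L$-smooth and let $T_0>0$. Let $(X(t),V(t))$, $t\ge T_0$, be the solution of the ODE system $$\frac{\mathrm{d}X}{\mathrm{d}t}=V,\qquad \frac{\mathrm{d}V}{\mathrm{d}t}=-\frac{2}{t}V-\frac{2}{t^{3/2}}\nabla f(X).$$ For each stepsize $\eta>0$ (small enough that $\lfloor T_0/\eta\rfloor\ge 1$), let $\{(x_k,v_k)\}$ (depending on $\eta$) be generated for $k>\lfloor T_0/\eta\rfloor$ by $$x_k-x_{k-1}=\eta v_{k-1},\qquad v_k-v_{k-1}=-\frac{2}{k}v_k-\frac{2}{k}\cdot\frac{1}{\sqrt{k\eta}}\,g(x_k,\xi_k),$$ where $g(x_k,\xi_k)=\nabla f(x_k)+\xi_k$ and the $\xi_k$ are i.i.d. $\mathcal{N}(0,I_n)$. Suppose $x_{T_0/\eta}=X(T_0)$ and $v_{T_0/\eta}=V(T_0)$ for every such $\eta$. Then for every $T>T_0$, $$\lim_{\eta\to0}\mathbb{E}\left[\|x_{T/\eta}-X(T)\|^2\right]=0.$$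
   Context: $\|\cdot\|$ is the Euclidean norm. $f$ is $L$-smooth if it is differentiable and $\|\nabla f(x)-\nabla f(y)\|\le L\|x-y\|$ for all $x,y\in\mathbb{R}^n$. In subscripts of $x$ and $v$, the quantities $T_0/\eta$ and $T/\eta$ are understood as their integer parts $\lfloor T_0/\eta\rfloor$ and $\lfloor T/\eta\rfloor$. The discrete scheme (Stochastic Gradient Descent with Momentum, SGDM) is started at index $\lfloor T_0/\eta\rfloor$ from the values $(X(T_0),V(T_0))$, which do not depend on $\eta$. *)

theory Defs
  imports "HOL-Probability.Probability"
begin

definition gradient :: "('a::real_inner \<Rightarrow> real) \<Rightarrow> 'a \<Rightarrow> 'a" where
  "gradient f x = (THE D. GDERIV f x :> D)"

definition L_smooth :: "real \<Rightarrow> ('a::real_inner \<Rightarrow> real) \<Rightarrow> bool" where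
  "L_smooth L f \<longleftrightarrow>
     (\<forall>x. f differentiable (at x)) \<and>
     (\<forall>x y. norm (gradient f x - gradient f y) \<le> L * norm (x - y))"

text \<open>Lebesgue density of the normal distribution N(0, I); the covariance being diagonal, it is the
  product of the one-dimensional standard normal densities of the coordinates.\<close>

definition std_normal_density_vec :: "real ^ 'n \<Rightarrow> real" where
  "std_normal_density_vec y = (\<Prod>i\<in>UNIV. std_normal_density (y $ i))"

text \<open>Sanity check: for a differentiable function on a Euclidean space, the definite description
  in the gradient denotes, so it is the library's derivative in inner-product form.\<close>

lemma gradient_eq: "GDERIV f x :> D \<Longrightarrow> gradient f x = D"
proof -
  assume D: "GDERIV f x :> D"
  have "E = D" if E: "GDERIV f x :> E" for E
  proof -
    have "(\<lambda>h. inner h E) = (\<lambda>h. inner h D)"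
      using D E unfolding gderiv_def by (rule has_derivative_unique[rotated])
    then have "inner (E - D) E = inner (E - D) D" by metis
    then have "inner (E - D) (E - D) = 0" by (simp add: inner_diff_right)
    then show ?thesis by simp
  qed
  with D show ?thesis unfolding gradient_def by blast
qed

lemma GDERIV_gradient:
  fixes f :: "'a::euclidean_space \<Rightarrow> real"
  assumes "f differentiable (at x)"
  shows "GDERIV f x :> gradient f x"
proof -
  from assms obtain f' where f': "(f has_derivative f') (at x)"
    unfolding differentiable_def by blast
  then have lin: "linear f'" by (rule has_derivative_linear)
  have "f' = (\<lambda>h. inner h (adjoint f' 1))"
    using adjoint_works[OF lin, of _ 1] by (simp add: fun_eq_iff inner_commute)
  with f' have "GDERIV f x :> adjoint f' 1" unfolding gderiv_def by simp
  with gradient_eq show ?thesis by metis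
qed

end

theory Submission
  imports Defs
begin

text \<open>With $t_k = k\eta$, the velocity step of the scheme is
  $$v_k - v_{k-1} = \eta \Bigl(-\frac{2}{t_k} v_k - \frac{2}{t_k^{3/2}} (\nabla f(x_k) + \xi_k)\Bigr),$$
  so the scheme is a semi-implicit Euler discretization of the differential equation, driven in
  addition by the increments $2\eta\, t_k^{-3/2} \xi_k$.  On a time interval of length of order $1$
  there are about $1/\eta$ of these independent centred increments, each of variance of order
  $\eta^2$.  Their sum has variance of order $\eta$ and disappears in the limit: the noise averages out.

  To turn this into a proof, compare $(x_k, v_k)$ with the solution at times $s_k$ that run in steps
  of \<open>\<eta>\<close> from \<open>T0\<close>.  The solution satisfies the noiseless scheme up to an error
  \<open>\<epsilon> * \<eta>\<close> per step (\<open>momentum_ode_consistency\<close>, by uniform continuity on compact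
  intervals).  Multiplying the velocity error equation by $k(k+1)$ removes the friction term, so that
  the velocity error is bounded, for each outcome, by the position errors up to then, the accumulated
  defects and the norm of a weighted sum $n_k$ of the $\xi_j$.  The force is Lipschitz, and a discrete Gronwall
  inequality (\<open>momentum_recursion_stability\<close>) yields
  $$\|x_k - X(s_k)\| \le C \Bigl(\varepsilon + \eta \sum_j \|n_j\|\Bigr).$$
  Squaring and taking expectations leaves only $E \|n_j\|^2 = O(\eta)$, which follows from
  independence and the Gaussian moments (\<open>second_moment_indep_vector_sum\<close>,
  \<open>std_normal_vec_moments\<close>).  The resulting bound $O(\varepsilon^2 + \eta)$ holds for every
  \<open>\<epsilon>\<close> once \<open>\<eta>\<close> is small enough.\<close>

section \<open>Second moments of sums of independent Gaussian vectors\<close>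

text \<open>The cross terms $2 Y_i \sum_{k \in A} Y_k$ have expectation $0$, because $Y_i$ is centred and
  independent of the sum of the others.  Integrability of the sum is carried along in the induction,
  since it is what makes the product formula for independent variables applicable.\<close>

lemma (in prob_space) second_moment_indep_sum:
  fixes Y :: "'i \<Rightarrow> 'a \<Rightarrow> real"
  assumes "finite A" and "indep_vars (\<lambda>_. borel) Y A"
    and sq: "\<And>k. k \<in> A \<Longrightarrow> integrable M (\<lambda>\<omega>. (Y k \<omega>)\<^sup>2)"
    and mean: "\<And>k. k \<in> A \<Longrightarrow> expectation (Y k) = 0"
  shows "integrable M (\<lambda>\<omega>. (\<Sum>k\<in>A. Y k \<omega>)\<^sup>2) \<and> integrable M (\<lambda>\<omega>. \<Sum>k\<in>A. Y k \<omega>)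
    \<and> expectation (\<lambda>\<omega>. (\<Sum>k\<in>A. Y k \<omega>)\<^sup>2) = (\<Sum>k\<in>A. expectation (\<lambda>\<omega>. (Y k \<omega>)\<^sup>2))"
  using assms
proof (induction A rule: finite_induct)
  case empty
  then show ?case by simp
next
  case (insert i A)
  let ?S = "\<lambda>\<omega>. \<Sum>k\<in>A. Y k \<omega>"
  have IH: "integrable M (\<lambda>\<omega>. (?S \<omega>)\<^sup>2)" "integrable M ?S"
      "expectation (\<lambda>\<omega>. (?S \<omega>)\<^sup>2) = (\<Sum>k\<in>A. expectation (\<lambda>\<omega>. (Y k \<omega>)\<^sup>2))"
    using insert.IH insert.prems indep_vars_subset[OF insert.prems(1)] by auto
  have meas: "random_variable borel (Y i)"
    using insert.prems(1) by (auto simp: indep_vars_def)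
  have sq_i: "integrable M (\<lambda>\<omega>. (Y i \<omega>)\<^sup>2)" and mean_i: "expectation (Y i) = 0"
    using insert.prems by auto
  have int_i: "integrable M (Y i)"
    by (rule square_integrable_imp_integrable[OF meas sq_i])
  have ind: "indep_var borel (Y i) borel ?S"
    using indep_vars_sum[OF insert.hyps(1,2) insert.prems(1)] .
  have cross: "integrable M (\<lambda>\<omega>. Y i \<omega> * ?S \<omega>)" "expectation (\<lambda>\<omega>. Y i \<omega> * ?S \<omega>) = 0"
    using indep_var_integrable[OF ind int_i IH(2)] indep_var_lebesgue_integral[OF ind int_i IH(2)] mean_i
    by auto
  have expand: "(\<Sum>k\<in>insert i A. Y k \<omega>)\<^sup>2 = (Y i \<omega>)\<^sup>2 + 2 * (Y i \<omega> * ?S \<omega>) + (?S \<omega>)\<^sup>2" for \<omega>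
    using insert.hyps by (simp add: power2_sum)
  show ?case
    unfolding expand using insert.hyps sq_i int_i IH cross by simp
qed

text \<open>Squaring coordinate by coordinate reduces the vector sum to the scalar case, because
  for each fixed coordinate the entries of the vectors \<open>Z k\<close> are again independent in \<open>k\<close>.\<close>

lemma (in prob_space) second_moment_indep_vector_sum:
  fixes Z :: "'i \<Rightarrow> 'a \<Rightarrow> real ^ 'n" and c :: "'i \<Rightarrow> real"
  assumes fin: "finite A" and ind: "indep_vars (\<lambda>_. borel) Z A"
    and sq: "\<And>k j. k \<in> A \<Longrightarrow> integrable M (\<lambda>\<omega>. (Z k \<omega> $ j)\<^sup>2)"
    and mean: "\<And>k j. k \<in> A \<Longrightarrow> expectation (\<lambda>\<omega>. Z k \<omega> $ j) = 0"
    and var: "\<And>k j. k \<in> A \<Longrightarrow> expectation (\<lambda>\<omega>. (Z k \<omega> $ j)\<^sup>2) = 1"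
  shows "integrable M (\<lambda>\<omega>. (norm (\<Sum>k\<in>A. c k *\<^sub>R Z k \<omega>))\<^sup>2)"
    and "expectation (\<lambda>\<omega>. (norm (\<Sum>k\<in>A. c k *\<^sub>R Z k \<omega>))\<^sup>2) = CARD('n) * (\<Sum>k\<in>A. (c k)\<^sup>2)"
proof -
  have norm_eq: "(norm (\<Sum>k\<in>A. c k *\<^sub>R Z k \<omega>))\<^sup>2 = (\<Sum>j\<in>UNIV. (\<Sum>k\<in>A. c k * Z k \<omega> $ j)\<^sup>2)" for \<omega>
    by (simp add: power2_norm_eq_inner inner_vec_def power2_eq_square[symmetric] del: sum_power2_eq_zero_iff)
  have coord: "integrable M (\<lambda>\<omega>. (\<Sum>k\<in>A. c k * Z k \<omega> $ j)\<^sup>2)"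
    "expectation (\<lambda>\<omega>. (\<Sum>k\<in>A. c k * Z k \<omega> $ j)\<^sup>2) = (\<Sum>k\<in>A. (c k)\<^sup>2)" for j
  proof -
    have "indep_vars (\<lambda>_. borel) (\<lambda>k \<omega>. c k * Z k \<omega> $ j) A"
      by (rule indep_vars_compose2[OF ind, of "\<lambda>k z. c k * z $ j"]) measurable
    from second_moment_indep_sum[OF fin this] sq mean var
    show "integrable M (\<lambda>\<omega>. (\<Sum>k\<in>A. c k * Z k \<omega> $ j)\<^sup>2)"
      "expectation (\<lambda>\<omega>. (\<Sum>k\<in>A. c k * Z k \<omega> $ j)\<^sup>2) = (\<Sum>k\<in>A. (c k)\<^sup>2)"
      by (auto simp: power_mult_distrib)
  qed
  show "integrable M (\<lambda>\<omega>. (norm (\<Sum>k\<in>A. c k *\<^sub>R Z k \<omega>))\<^sup>2)"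
    unfolding norm_eq using coord by simp
  show "expectation (\<lambda>\<omega>. (norm (\<Sum>k\<in>A. c k *\<^sub>R Z k \<omega>))\<^sup>2) = CARD('n) * (\<Sum>k\<in>A. (c k)\<^sup>2)"
    unfolding norm_eq using coord by simp
qed

lemma integral_lborel_odd_eq_0:
  fixes g :: "'a::euclidean_space \<Rightarrow> real"
  assumes [measurable]: "g \<in> borel_measurable borel" and odd: "\<And>y. g (- y) = - g y"
  shows "integral\<^sup>L lborel g = 0"
proof -
  have "lborel = density (distr lborel borel (\<lambda>x::'a. - x)) (\<lambda>_. 1)"
    using lborel_affine[of "-1" "0::'a"] by simp
  then have "integral\<^sup>L lborel g = integral\<^sup>L (density (distr lborel borel (\<lambda>x::'a. - x)) (\<lambda>_. 1)) g"
    by simp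
  also have "\<dots> = (\<integral>y. g (- y) \<partial>lborel)"
    by (simp add: density_1 integral_distr)
  finally show ?thesis
    by (simp add: odd)
qed

text \<open>The mean vanishes because the density is even.  For the second moment of one coordinate, the
  integrand is a product of functions of single coordinates, so the integral over $\mathbb{R}^n$
  factors into one-dimensional Gaussian moments, all equal to $1$.\<close>

lemma (in prob_space) std_normal_vec_moments:
  fixes Z :: "'a \<Rightarrow> real ^ 'n"
  assumes D: "distributed M lborel Z (\<lambda>y. ennreal (std_normal_density_vec y))"
  shows "expectation (\<lambda>\<omega>. Z \<omega> $ i) = 0"
    and "integrable M (\<lambda>\<omega>. (Z \<omega> $ i)\<^sup>2)"
    and "expectation (\<lambda>\<omega>. (Z \<omega> $ i)\<^sup>2) = 1"
proof -
  have nonneg: "0 \<le> std_normal_density_vec y" for y :: "real ^ 'n"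
    by (simp add: std_normal_density_vec_def prod_nonneg)
  have [measurable]: "std_normal_density_vec \<in> borel_measurable (borel :: (real ^ 'n) measure)"
    unfolding std_normal_density_vec_def[abs_def] by measurable
  have "(\<integral>y. std_normal_density_vec y * y $ i \<partial>lborel) = 0"
    by (rule integral_lborel_odd_eq_0)
       (simp_all add: std_normal_density_vec_def std_normal_density_def)
  then show "expectation (\<lambda>\<omega>. Z \<omega> $ i) = 0"
    using distributed_integral[OF D, of "\<lambda>y. y $ i"] nonneg by simp
  have coord: "(\<Prod>b\<in>Basis. h b (y \<bullet> b)) = (\<Prod>j\<in>UNIV. h (axis j 1) (y $ j))"
    for h :: "real ^ 'n \<Rightarrow> real \<Rightarrow> ennreal" and y
  proof -
    have range: "Basis = range (\<lambda>j. axis j 1 :: real ^ 'n)"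
      by (auto simp: Basis_vec_def)
    have inj: "inj (\<lambda>j. axis j 1 :: real ^ 'n)"
      by (auto simp: inj_on_def axis_eq_axis)
    show ?thesis
      unfolding range by (subst prod.reindex[OF inj]) (simp add: inner_axis)
  qed
  \<comment> \<open>The factor contributed by the coordinate \<open>b\<close>: the extra square sits on coordinate \<open>i\<close> only.\<close>
  define h where "h b t = ennreal (std_normal_density t * (if b = axis i 1 then t\<^sup>2 else 1))"
    for b :: "real ^ 'n" and t
  have h: "(\<integral>\<^sup>+t. h b t \<partial>lborel) = 1" for b
  proof (cases "b = axis i 1")
    case True
    have "(\<integral>\<^sup>+t. ennreal (std_normal_density t * t\<^sup>2) \<partial>lborel) = ennreal 1"
      using std_normal_moment_even[of 1]
      by (intro nn_integral_eq_integral[THEN trans])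
         (auto simp: has_bochner_integral_iff fact_2)
    then show ?thesis
      using True by (simp add: h_def)
  next
    case False
    have "(\<integral>\<^sup>+t. ennreal (std_normal_density t) \<partial>lborel) = ennreal 1"
      using std_normal_moment_even[of 0]
      by (intro nn_integral_eq_integral[THEN trans])
         (auto simp: has_bochner_integral_iff)
    then show ?thesis
      using False by (simp add: h_def)
  qed
  have split: "ennreal (std_normal_density_vec y) * ennreal ((y $ i)\<^sup>2) = (\<Prod>b\<in>Basis. h b (y \<bullet> b))" for y
  proof -
    have "(\<Prod>j\<in>UNIV. h (axis j 1) (y $ j))
        = (\<Prod>j\<in>UNIV. ennreal (std_normal_density (y $ j) * (if j = i then (y $ j)\<^sup>2 else 1)))"
      by (intro prod.cong) (auto simp: h_def axis_eq_axis)
    also have "\<dots> = ennreal (\<Prod>j\<in>UNIV. std_normal_density (y $ j) * (if j = i then (y $ j)\<^sup>2 else 1))"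
      by (rule prod_ennreal) auto
    also have "\<dots> = ennreal (std_normal_density_vec y * (y $ i)\<^sup>2)"
      by (simp add: prod.distrib std_normal_density_vec_def)
    finally show ?thesis
      by (simp add: coord ennreal_mult nonneg)
  qed
  have "(\<integral>\<^sup>+\<omega>. ennreal ((Z \<omega> $ i)\<^sup>2) \<partial>M)
      = (\<integral>\<^sup>+y. ennreal (std_normal_density_vec y) * ennreal ((y $ i)\<^sup>2) \<partial>lborel)"
    using distributed_nn_integral[OF D, of "\<lambda>y. ennreal ((y $ i)\<^sup>2)"] by simp
  also have "\<dots> = (\<Prod>b\<in>Basis. \<integral>\<^sup>+t. h b t \<partial>lborel)"
    unfolding split by (rule nn_integral_lborel_prod) (simp_all add: h_def)
  also have "\<dots> = ennreal 1"
    by (simp add: h)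
  finally have nn: "(\<integral>\<^sup>+\<omega>. ennreal ((Z \<omega> $ i)\<^sup>2) \<partial>M) = ennreal 1" .
  have [measurable]: "random_variable borel Z"
    using distributed_measurable[OF D] by simp
  have meas: "random_variable borel (\<lambda>\<omega>. (Z \<omega> $ i)\<^sup>2)"
    by (rule measurable_compose[where g = "\<lambda>z. (z $ i)\<^sup>2"]) measurable
  have "has_bochner_integral M (\<lambda>\<omega>. (Z \<omega> $ i)\<^sup>2) 1"
    by (rule has_bochner_integral_nn_integral[OF meas]) (use nn in simp_all)
  then show "integrable M (\<lambda>\<omega>. (Z \<omega> $ i)\<^sup>2)" "expectation (\<lambda>\<omega>. (Z \<omega> $ i)\<^sup>2) = 1"
    by (auto simp: has_bochner_integral_iff)
qed

section \<open>Stability of the momentum recursion\<close>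

lemma discrete_gronwall:
  fixes u :: "nat \<Rightarrow> real"
  assumes "0 \<le> c" and "0 \<le> b"
    and u: "\<And>k. k \<le> N \<Longrightarrow> u k \<le> b + c * (\<Sum>i<k. u i)"
    and "k \<le> N"
  shows "u k \<le> b * (1 + c) ^ k"
  using \<open>k \<le> N\<close>
proof (induction k rule: less_induct)
  case (less k)
  have "u k \<le> b + c * (\<Sum>i<k. u i)"
    using u less.prems .
  also have "\<dots> \<le> b + c * (\<Sum>i<k. b * (1 + c) ^ i)"
    using less \<open>0 \<le> c\<close> by (intro add_left_mono mult_left_mono sum_mono) auto
  also have "\<dots> = b * (1 + c) ^ k"
  proof -
    have "1 + c * (\<Sum>i<k. (1 + c) ^ i) = (1 + c) ^ k"
      using power_diff_1_eq[of "1 + c" k] by simp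
    moreover have "b + c * (\<Sum>i<k. b * (1 + c) ^ i) = b * (1 + c * (\<Sum>i<k. (1 + c) ^ i))"
      by (simp add: sum_distrib_left[symmetric] algebra_simps)
    ultimately show ?thesis
      by simp
  qed
  finally show ?case .
qed

text \<open>This is the stability half of the argument, for an arbitrary error recursion.  Here
  \<open>e\<close> and \<open>d\<close> are the errors of position and velocity, \<open>q\<close> and \<open>R\<close> the
  deterministic defects (\<open>R\<close> may also contain the position error, through the Lipschitz
  force), and \<open>z\<close> the noise.  The weights \<open>P\<close> are the integrating factor of the friction
  term: multiplied by them, the velocity recursion has no damping and can be summed exactly.
  Since \<open>P\<close> increases, dividing by \<open>P k\<close> at the end costs nothing, and the noise enters
  only through the weighted partial sums.  Inserting the velocity bound into the position
  recursion gives a Gronwall inequality for \<open>e\<close>.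

  No absolute values are taken inside the noise sums: a bound by
  $\sum_i \|z_i\|$ would be of order $1$ instead of $\sqrt\eta$ and would lose the
  cancellation between independent increments.\<close>

lemma momentum_recursion_stability:
  fixes e d q R z :: "nat \<Rightarrow> 'a::real_normed_vector" and P :: "nat \<Rightarrow> real"
  assumes nonneg: "0 \<le> \<eta>" "0 \<le> a" "0 \<le> \<epsilon>" and S: "real N * \<eta> \<le> S"
    and init: "e 0 = 0" "d 0 = 0"
    and e_step: "\<And>i. i < N \<Longrightarrow> e (Suc i) = e i + \<eta> *\<^sub>R d i + q i"
    and q: "\<And>i. i < N \<Longrightarrow> norm (q i) \<le> \<epsilon> * \<eta>"
    and P: "\<And>i. 0 < P i" "mono P"
    and d_step: "\<And>i. i < N \<Longrightarrow> P (Suc i) *\<^sub>R d (Suc i) = P i *\<^sub>R d i - R i - z i"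
    and R: "\<And>i. i < N \<Longrightarrow> norm (R i) \<le> P (Suc i) * (a * \<eta> * norm (e (Suc i)) + \<epsilon> * \<eta>)"
  shows "norm (e N) \<le> exp (a * S\<^sup>2) *
      (\<epsilon> * (S\<^sup>2 + S) + \<eta> * (\<Sum>j<N. norm ((1 / P j) *\<^sub>R (\<Sum>i<j. z i))))"
proof -
  define n where "n j = norm ((1 / P j) *\<^sub>R (\<Sum>i<j. z i))" for j
  have kS: "real k * \<eta> \<le> S" if "k \<le> N" for k
    using that nonneg S mult_right_mono[of "real k" "real N" \<eta>] by simp
  have S0: "0 \<le> S"
    using kS[of 0] by simp
  \<comment> \<open>The undamped velocity recursion telescopes.\<close>
  have Pd: "P k *\<^sub>R d k = - (\<Sum>i<k. R i) - (\<Sum>i<k. z i)" if "k \<le> N" for k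
    using that by (induction k) (simp_all add: init d_step)
  have d_bound: "norm (d k) \<le> (\<Sum>i<k. a * \<eta> * norm (e (Suc i)) + \<epsilon> * \<eta>) + n k" if "k \<le> N" for k
  proof -
    have "d k = (1 / P k) *\<^sub>R (P k *\<^sub>R d k)"
      using P(1)[of k] by simp
    also have "\<dots> = - ((1 / P k) *\<^sub>R (\<Sum>i<k. R i)) - (1 / P k) *\<^sub>R (\<Sum>i<k. z i)"
      unfolding Pd[OF that] by (simp add: scaleR_diff_right)
    finally have "norm (d k) \<le> norm ((1 / P k) *\<^sub>R (\<Sum>i<k. R i)) + n k"
      unfolding n_def by (metis norm_minus_cancel norm_triangle_ineq4)
    moreover have "norm ((1 / P k) *\<^sub>R (\<Sum>i<k. R i)) \<le> (\<Sum>i<k. a * \<eta> * norm (e (Suc i)) + \<epsilon> * \<eta>)"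
    proof -
      have "norm (\<Sum>i<k. R i) \<le> (\<Sum>i<k. P k * (a * \<eta> * norm (e (Suc i)) + \<epsilon> * \<eta>))"
      proof (rule sum_norm_le)
        fix i assume "i \<in> {..<k}"
        then have i: "i < N" "Suc i \<le> k"
          using that by auto
        have "P (Suc i) * (a * \<eta> * norm (e (Suc i)) + \<epsilon> * \<eta>) \<le> P k * (a * \<eta> * norm (e (Suc i)) + \<epsilon> * \<eta>)"
          using monoD[OF P(2) i(2)] nonneg by (intro mult_right_mono) auto
        with R[OF i(1)] show "norm (R i) \<le> P k * (a * \<eta> * norm (e (Suc i)) + \<epsilon> * \<eta>)"
          by simp
      qed
      then show ?thesis
        using P(1)[of k] by (simp add: sum_distrib_left[symmetric] divide_simps mult.commute)
    qed
    ultimately show ?thesis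
      by simp
  qed
  have e_bound: "norm (e k) \<le> (\<Sum>j<k. \<eta> * norm (d j) + \<epsilon> * \<eta>)" if "k \<le> N" for k
    using that
  proof (induction k)
    case 0
    then show ?case by (simp add: init)
  next
    case (Suc k)
    have "norm (e (Suc k)) \<le> norm (e k) + norm (\<eta> *\<^sub>R d k) + norm (q k)"
      using Suc.prems e_step[of k] norm_triangle_ineq[of "e k + \<eta> *\<^sub>R d k" "q k"]
        norm_triangle_ineq[of "e k" "\<eta> *\<^sub>R d k"] by simp
    then show ?case
      using Suc q[of k] nonneg by simp
  qed
  have gron: "norm (e k) \<le> (\<epsilon> * (S\<^sup>2 + S) + \<eta> * (\<Sum>j<N. n j)) + (a * S * \<eta>) * (\<Sum>i<k. norm (e i))"
    if k: "k \<le> N" for k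
  proof -
    define E where "E = (\<Sum>i<k. norm (e i))"
    have E0: "0 \<le> E"
      unfolding E_def by (simp add: sum_nonneg)
    have dj: "norm (d j) \<le> a * \<eta> * E + \<epsilon> * S + n j" if "j < k" for j
    proof -
      \<comment> \<open>The velocity error at \<open>j\<close> sees the position errors up to index \<open>j\<close>, which is
        strictly below \<open>k\<close>; this is what makes the Gronwall inequality explicit.\<close>
      have "(\<Sum>i<j. norm (e (Suc i))) = (\<Sum>i<Suc j. norm (e i))"
        by (simp add: sum.lessThan_Suc_shift init del: sum.lessThan_Suc)
      also have "\<dots> \<le> E"
        unfolding E_def using that by (intro sum_mono2) auto
      finally have "a * \<eta> * (\<Sum>i<j. norm (e (Suc i))) \<le> a * \<eta> * E"
        using nonneg by (intro mult_left_mono) auto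
      moreover have "real j * (\<epsilon> * \<eta>) \<le> \<epsilon> * S"
        using mult_left_mono[OF kS[of j] nonneg(3)] that k by (simp add: mult_ac)
      moreover have "norm (d j) \<le> a * \<eta> * (\<Sum>i<j. norm (e (Suc i))) + real j * (\<epsilon> * \<eta>) + n j"
        using d_bound[of j] that k by (simp add: sum.distrib sum_distrib_left)
      ultimately show ?thesis
        by linarith
    qed
    have "norm (e k) \<le> (\<Sum>j<k. \<eta> * norm (d j) + \<epsilon> * \<eta>)"
      by (rule e_bound[OF k])
    also have "\<dots> \<le> (\<Sum>j<k. \<eta> * (a * \<eta> * E + \<epsilon> * S + n j) + \<epsilon> * \<eta>)"
      using dj nonneg by (intro sum_mono add_right_mono mult_left_mono) auto
    also have "\<dots> = (real k * \<eta>) * (a * \<eta> * E + \<epsilon> * S + \<epsilon>) + \<eta> * (\<Sum>j<k. n j)"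
      by (simp add: sum.distrib sum_distrib_left algebra_simps)
    also have "\<dots> \<le> S * (a * \<eta> * E + \<epsilon> * S + \<epsilon>) + \<eta> * (\<Sum>j<N. n j)"
      using kS[OF k] nonneg S0 E0 k
      by (intro add_mono mult_right_mono mult_left_mono sum_mono2) (auto simp: n_def)
    finally show ?thesis
      unfolding E_def by (simp add: algebra_simps power2_eq_square)
  qed
  have b0: "0 \<le> \<epsilon> * (S\<^sup>2 + S) + \<eta> * (\<Sum>j<N. n j)"
    using nonneg S0 by (auto simp: n_def intro!: add_nonneg_nonneg mult_nonneg_nonneg sum_nonneg)
  have "norm (e N) \<le> (\<epsilon> * (S\<^sup>2 + S) + \<eta> * (\<Sum>j<N. n j)) * (1 + a * S * \<eta>) ^ N"
    using discrete_gronwall[of "a * S * \<eta>" _ N "\<lambda>k. norm (e k)" N] gron b0 nonneg S0 by auto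
  also have "\<dots> \<le> (\<epsilon> * (S\<^sup>2 + S) + \<eta> * (\<Sum>j<N. n j)) * exp (a * S\<^sup>2)"
  proof (rule mult_left_mono[OF _ b0])
    have "(1 + a * S * \<eta>) ^ N \<le> exp (a * S * \<eta>) ^ N"
      using nonneg S0 exp_ge_add_one_self[of "a * S * \<eta>"] by (intro power_mono) auto
    also have "\<dots> = exp (a * S * (real N * \<eta>))"
      by (simp add: exp_of_nat_mult[symmetric] mult_ac)
    also have "\<dots> \<le> exp (a * S * S)"
      using nonneg S0 S by (auto intro!: mult_left_mono)
    finally show "(1 + a * S * \<eta>) ^ N \<le> exp (a * S\<^sup>2)"
      by (simp add: power2_eq_square mult.assoc)
  qed
  finally show ?thesis
    unfolding n_def by (simp add: mult.commute)
qed

section \<open>Consistency of the scheme with the differential equation\<close>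

text \<open>On a compact interval the derivative is uniformly continuous, so the first-order Taylor remainder
  is \<open>\<epsilon> * (t - s)\<close> uniformly in the base point.  The linearization may be taken at any
  point \<open>r\<close> between the two times: positions need the left end (explicit step), velocities the
  right end (implicit step).\<close>

lemma uniform_linearization:
  fixes \<phi> \<phi>' :: "real \<Rightarrow> 'a::real_normed_vector"
  assumes deriv: "\<And>t. t \<ge> a \<Longrightarrow> (\<phi> has_vector_derivative \<phi>' t) (at t within {a..})"
    and cont: "continuous_on {a..} \<phi>'" and "0 < \<epsilon>"
  obtains \<delta> where "0 < \<delta>"
    "\<And>s t r. a \<le> s \<Longrightarrow> s \<le> t \<Longrightarrow> t \<le> b \<Longrightarrow> t - s < \<delta> \<Longrightarrow> r \<in> {s..t} \<Longrightarrow>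
      norm (\<phi> t - \<phi> s - (t - s) *\<^sub>R \<phi>' r) \<le> \<epsilon> * (t - s)"
proof -
  have "uniformly_continuous_on {a..b} \<phi>'"
    by (rule compact_uniformly_continuous[OF continuous_on_subset[OF cont]]) auto
  then obtain \<delta> where \<delta>: "0 < \<delta>"
    "\<And>s t. s \<in> {a..b} \<Longrightarrow> t \<in> {a..b} \<Longrightarrow> dist s t < \<delta> \<Longrightarrow> dist (\<phi>' s) (\<phi>' t) < \<epsilon>"
    using \<open>0 < \<epsilon>\<close> unfolding uniformly_continuous_on_def by metis
  show thesis
  proof (rule that[OF \<delta>(1)])
    fix s t r assume *: "a \<le> s" "s \<le> t" "t \<le> b" "t - s < \<delta>" "r \<in> {s..t}"
    have "norm (\<phi> t - \<phi> s - (t - s) *\<^sub>R \<phi>' r) \<le> norm (t - s) * \<epsilon>"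
    proof (rule vector_differentiable_bound_linearization)
      fix y assume y: "y \<in> {s..t}"
      show "(\<phi> has_vector_derivative \<phi>' y) (at y within {s..t})"
        using deriv[of y] y * by (auto intro: has_vector_derivative_within_subset)
      have "dist (\<phi>' y) (\<phi>' r) < \<epsilon>"
        using y * by (intro \<delta>(2)) (auto simp: dist_real_def)
      then show "norm (\<phi>' y - \<phi>' r) \<le> \<epsilon>"
        by (simp add: dist_norm)
    qed (use * in \<open>auto simp: closed_segment_eq_real_ivl\<close>)
    with * show "norm (\<phi> t - \<phi> s - (t - s) *\<^sub>R \<phi>' r) \<le> \<epsilon> * (t - s)"
      by (simp add: mult.commute)
  qed
qed

text \<open>The consistency half: the solution of the differential equation satisfies one step of the scheme
  with defect \<open>\<epsilon> * \<eta>\<close>.  The time \<open>t\<close> at which the coefficients are evaluated may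
  differ by \<open>\<eta>\<close> from the time \<open>s + \<eta>\<close> of the solution, because the scheme starts at
  index $\lfloor T_0/\eta \rfloor$, hence at grid time $\lfloor T_0/\eta \rfloor\, \eta$, which is in general
  slightly less than $T_0$.\<close>

lemma momentum_ode_consistency:
  fixes X V :: "real \<Rightarrow> 'a::real_normed_vector" and G :: "'a \<Rightarrow> 'a"
  assumes T0: "0 < T0" and \<epsilon>: "0 < \<epsilon>"
    and G: "continuous_on UNIV G"
    and ode_X: "\<And>t. t \<ge> T0 \<Longrightarrow> (X has_vector_derivative V t) (at t within {T0..})"
    and ode_V: "\<And>t. t \<ge> T0 \<Longrightarrow> (V has_vector_derivative
        (- (2 / t) *\<^sub>R V t - (2 / t powr (3/2)) *\<^sub>R G (X t))) (at t within {T0..})"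
  obtains \<delta> where "0 < \<delta>"
    "\<And>\<eta> s t. 0 < \<eta> \<Longrightarrow> \<eta> < \<delta> \<Longrightarrow> T0 \<le> s \<Longrightarrow> s + \<eta> \<le> B \<Longrightarrow> T0 \<le> t \<Longrightarrow> t \<le> B \<Longrightarrow> \<bar>s + \<eta> - t\<bar> \<le> \<eta> \<Longrightarrow>
      norm (X (s + \<eta>) - X s - \<eta> *\<^sub>R V s) \<le> \<epsilon> * \<eta> \<and>
      norm (V (s + \<eta>) - V s + (\<eta> * (2 / t)) *\<^sub>R V (s + \<eta>)
        + (\<eta> * (2 / t powr (3/2))) *\<^sub>R G (X (s + \<eta>))) \<le> \<epsilon> * \<eta>"
proof -
  define W where "W t = - (2 / t) *\<^sub>R V t - (2 / t powr (3/2)) *\<^sub>R G (X t)" for t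
  have cX: "continuous_on {T0..} X" and cV: "continuous_on {T0..} V"
    using ode_X ode_V by (auto intro!: continuous_on_vector_derivative)
  have cGX: "continuous_on {T0..} (\<lambda>t. G (X t))"
    by (rule continuous_on_compose2[OF G cX]) auto
  have cW: "continuous_on {T0..} W"
    unfolding W_def using T0 by (intro continuous_intros cV cGX) auto
  have "bounded (V ` {T0..B})" "bounded ((\<lambda>t. G (X t)) ` {T0..B})"
    by (intro compact_imp_bounded compact_continuous_image continuous_on_subset[OF cV]
        continuous_on_subset[OF cGX]; auto)+
  then obtain M1 M2 where M: "\<And>t. t \<in> {T0..B} \<Longrightarrow> norm (V t) \<le> M1" "\<And>t. t \<in> {T0..B} \<Longrightarrow> norm (G (X t)) \<le> M2"
    unfolding bounded_iff by fast
  \<comment> \<open>The tolerance is shared by three defects: the Taylor remainder, and the shifted coefficients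
    of the friction and of the force, which are multiplied by the bounds \<open>M1\<close> and \<open>M2\<close>.\<close>
  define \<epsilon>' where "\<epsilon>' = \<epsilon> / (1 + \<bar>M1\<bar> + \<bar>M2\<bar>)"
  have \<epsilon>': "0 < \<epsilon>'" "\<epsilon>' * (1 + \<bar>M1\<bar> + \<bar>M2\<bar>) = \<epsilon>"
    using \<epsilon> by (auto simp: \<epsilon>'_def add_pos_nonneg intro!: divide_pos_pos)
  obtain \<delta>X where \<delta>X: "0 < \<delta>X" "\<And>s t r. T0 \<le> s \<Longrightarrow> s \<le> t \<Longrightarrow> t \<le> B \<Longrightarrow> t - s < \<delta>X \<Longrightarrow> r \<in> {s..t} \<Longrightarrow>
      norm (X t - X s - (t - s) *\<^sub>R V r) \<le> \<epsilon> * (t - s)"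
    using uniform_linearization[OF ode_X cV \<epsilon>, where b = B] by blast
  obtain \<delta>V where \<delta>V: "0 < \<delta>V" "\<And>s t r. T0 \<le> s \<Longrightarrow> s \<le> t \<Longrightarrow> t \<le> B \<Longrightarrow> t - s < \<delta>V \<Longrightarrow> r \<in> {s..t} \<Longrightarrow>
      norm (V t - V s - (t - s) *\<^sub>R W r) \<le> \<epsilon>' * (t - s)"
    using uniform_linearization[OF ode_V[folded W_def] cW \<epsilon>'(1), where b = B] by blast
  have "uniformly_continuous_on {T0..B} (\<lambda>t. 2 / t)"
    "uniformly_continuous_on {T0..B} (\<lambda>t. 2 / t powr (3/2))"
    using T0 by (auto intro!: compact_uniformly_continuous continuous_intros)
  then obtain \<delta>1 \<delta>2 where \<delta>12: "0 < \<delta>1" "0 < \<delta>2"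
    "\<And>s t. s \<in> {T0..B} \<Longrightarrow> t \<in> {T0..B} \<Longrightarrow> dist s t < \<delta>1 \<Longrightarrow> dist (2 / s) (2 / t) < \<epsilon>'"
    "\<And>s t. s \<in> {T0..B} \<Longrightarrow> t \<in> {T0..B} \<Longrightarrow> dist s t < \<delta>2 \<Longrightarrow>
      dist (2 / s powr (3/2)) (2 / t powr (3/2)) < \<epsilon>'"
    using \<epsilon>'(1) unfolding uniformly_continuous_on_def by metis
  show thesis
  proof (rule that[of "Min {\<delta>X, \<delta>V, \<delta>1, \<delta>2}"])
    show "0 < Min {\<delta>X, \<delta>V, \<delta>1, \<delta>2}"
      using \<delta>X \<delta>V \<delta>12 by simp
  next
    fix \<eta> s t
    assume *: "0 < \<eta>" "\<eta> < Min {\<delta>X, \<delta>V, \<delta>1, \<delta>2}" "T0 \<le> s" "s + \<eta> \<le> B" "T0 \<le> t" "t \<le> B" "\<bar>s + \<eta> - t\<bar> \<le> \<eta>"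
    define u where "u = s + \<eta>"
    have u: "u \<in> {T0..B}" "t \<in> {T0..B}" "u - s = \<eta>"
      using * T0 by (auto simp: u_def)
    have "norm (X u - X s - \<eta> *\<^sub>R V s) \<le> \<epsilon> * \<eta>"
      using \<delta>X(2)[of s u s] * by (simp add: u_def)
    moreover have "norm (V u - V s + (\<eta> * (2 / t)) *\<^sub>R V u + (\<eta> * (2 / t powr (3/2))) *\<^sub>R G (X u)) \<le> \<epsilon> * \<eta>"
    proof -
      have 1: "norm (V u - V s - \<eta> *\<^sub>R W u) \<le> \<epsilon>' * \<eta>"
        using \<delta>V(2)[of s u u] * by (simp add: u_def)
      have "\<bar>2 / t - 2 / u\<bar> \<le> \<epsilon>'" "\<bar>2 / t powr (3/2) - 2 / u powr (3/2)\<bar> \<le> \<epsilon>'"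
        using \<delta>12(3)[of t u] \<delta>12(4)[of t u] u * by (auto simp: dist_real_def u_def abs_minus_commute)
      then have 2: "norm ((\<eta> * (2 / t - 2 / u)) *\<^sub>R V u) \<le> \<eta> * \<epsilon>' * \<bar>M1\<bar>"
        "norm ((\<eta> * (2 / t powr (3/2) - 2 / u powr (3/2))) *\<^sub>R G (X u)) \<le> \<eta> * \<epsilon>' * \<bar>M2\<bar>"
        using M[OF u(1)] * \<epsilon>'(1)
        by (auto simp: abs_mult intro!: mult_mono)
      have "V u - V s + (\<eta> * (2 / t)) *\<^sub>R V u + (\<eta> * (2 / t powr (3/2))) *\<^sub>R G (X u)
         = (V u - V s - \<eta> *\<^sub>R W u) + (\<eta> * (2 / t - 2 / u)) *\<^sub>R V u
           + (\<eta> * (2 / t powr (3/2) - 2 / u powr (3/2))) *\<^sub>R G (X u)"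
        by (simp add: W_def algebra_simps)
      also have "norm \<dots> \<le> \<epsilon>' * \<eta> + \<eta> * \<epsilon>' * \<bar>M1\<bar> + \<eta> * \<epsilon>' * \<bar>M2\<bar>"
        using 1 2 by (intro norm_triangle_mono)
      also have "\<dots> = \<epsilon>' * (1 + \<bar>M1\<bar> + \<bar>M2\<bar>) * \<eta>"
        by (simp add: algebra_simps)
      finally show ?thesis
        unfolding \<epsilon>'(2) .
    qed
    ultimately show "norm (X (s + \<eta>) - X s - \<eta> *\<^sub>R V s) \<le> \<epsilon> * \<eta> \<and>
      norm (V (s + \<eta>) - V s + (\<eta> * (2 / t)) *\<^sub>R V (s + \<eta>)
        + (\<eta> * (2 / t powr (3/2))) *\<^sub>R G (X (s + \<eta>))) \<le> \<epsilon> * \<eta>"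
      by (simp add: u_def)
  qed
qed

section \<open>The mean square error for a fixed stepsize\<close>

text \<open>Stability combined with the second moment of the noise, for one fixed stepsize.  The reference
  path \<open>(p, u)\<close> is arbitrary, as long as it satisfies the noiseless scheme with defect
  \<open>\<epsilon> * \<eta>\<close>.

  The friction step reads $v_k (1 + 2/k) = v_{k-1} - \dots$, and $k(k+1)(1 + 2/k) = (k+1)(k+2)$,
  so that $k(k+1)$ is an integrating factor; it is the discrete form of
  $(t^2 V)' = -2 \sqrt t\, \nabla f(X)$.  With it the pathwise error is controlled by the average
  $\eta \sum_j \|n_j\|$ of the weighted noise sums $n_j$.  Each $n_j$ is a fixed linear combination
  of at most \<open>S / \<eta>\<close> independent Gaussians with coefficients of order \<open>\<eta>\<close>, so its second
  moment is of order \<open>\<eta>\<close>.  The noise sums do not involve the iterates, and in the pathwise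
  bound they are averaged over \<open>j\<close>, so their individual second moments control the whole run.\<close>

lemma (in prob_space) sgdm_mean_square_error:
  fixes x v \<xi> :: "nat \<Rightarrow> 'a \<Rightarrow> real ^ 'n" and p u :: "nat \<Rightarrow> real ^ 'n"
    and \<eta> S \<epsilon> L \<beta> C :: real
  assumes \<eta>: "0 < \<eta>" and S: "real N * \<eta> \<le> S" and nonneg: "0 \<le> \<epsilon>" "0 \<le> L" "0 \<le> \<beta>"
    and lip: "\<And>y z. norm (G y - G z) \<le> L * norm (y - z)"
    and indep: "indep_vars (\<lambda>_. borel) \<xi> {m<..}"
    and normal: "\<And>k. k > m \<Longrightarrow> distributed M lborel (\<xi> k) (\<lambda>y. ennreal (std_normal_density_vec y))"
    and init: "\<And>\<omega>. \<omega> \<in> space M \<Longrightarrow> x m \<omega> = p 0" "\<And>\<omega>. \<omega> \<in> space M \<Longrightarrow> v m \<omega> = u 0"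
    and x_step: "\<And>k \<omega>. k > m \<Longrightarrow> \<omega> \<in> space M \<Longrightarrow> x k \<omega> - x (k - 1) \<omega> = \<eta> *\<^sub>R v (k - 1) \<omega>"
    and v_step: "\<And>k \<omega>. k > m \<Longrightarrow> \<omega> \<in> space M \<Longrightarrow>
      v k \<omega> - v (k - 1) \<omega> = - (2 / real k) *\<^sub>R v k \<omega>
        - (2 / real k * (1 / sqrt (real k * \<eta>))) *\<^sub>R (G (x k \<omega>) + \<xi> k \<omega>)"
    and \<beta>: "\<And>k. m < k \<Longrightarrow> k \<le> m + N \<Longrightarrow> 2 / real k * (1 / sqrt (real k * \<eta>)) \<le> \<beta> * \<eta>"
    and p: "\<And>i. i < N \<Longrightarrow> norm (p (Suc i) - p i - \<eta> *\<^sub>R u i) \<le> \<epsilon> * \<eta>"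
    and u: "\<And>i k. i < N \<Longrightarrow> k = m + Suc i \<Longrightarrow>
      norm (u (Suc i) - u i + (2 / real k) *\<^sub>R u (Suc i)
        + (2 / real k * (1 / sqrt (real k * \<eta>))) *\<^sub>R G (p (Suc i))) \<le> \<epsilon> * \<eta>"
    and C: "C = exp (\<beta> * L * S\<^sup>2) * (S\<^sup>2 + S + 1)"
  shows "random_variable borel (x (m + N))"
    and "integrable M (\<lambda>\<omega>. (norm (x (m + N) \<omega> - p N))\<^sup>2)"
    and "expectation (\<lambda>\<omega>. (norm (x (m + N) \<omega> - p N))\<^sup>2)
      \<le> 2 * C\<^sup>2 * (\<epsilon>\<^sup>2 + CARD('n) * \<beta>\<^sup>2 * S ^ 3 * \<eta>)"
proof -
  define \<gamma> where "\<gamma> k = 2 / real k * (1 / sqrt (real k * \<eta>))" for k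
  define P where "P i = real (m + i + 1) * real (m + i + 2)" for i
  define c where "c i = real (m + i + 1) * real (m + i + 2) * \<gamma> (m + Suc i)" for i
  define n where "n j \<omega> = (\<Sum>i<j. (c i / P j) *\<^sub>R \<xi> (m + Suc i) \<omega>)" for j \<omega>
  define A where "A \<omega> = \<eta> * (\<Sum>j<N. norm (n j \<omega>))" for \<omega>
  have S0: "0 \<le> S"
    using \<eta> by (intro order_trans[OF _ S]) simp
  have \<gamma>0: "0 \<le> \<gamma> k" for k
    using \<eta> by (simp add: \<gamma>_def)
  have P: "0 < P i" "mono P" for i
    by (auto simp: P_def intro!: monoI mult_mono)

  have path: "norm (x (m + N) \<omega> - p N) \<le> C * (\<epsilon> + A \<omega>)" if \<omega>: "\<omega> \<in> space M" for \<omega>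
  proof -
    define e where "e i = x (m + i) \<omega> - p i" for i
    define d where "d i = v (m + i) \<omega> - u i" for i
    define q where "q i = - (p (Suc i) - p i - \<eta> *\<^sub>R u i)" for i
    define \<rho> where "\<rho> i = u (Suc i) - u i + (2 / real (m + Suc i)) *\<^sub>R u (Suc i)
      + \<gamma> (m + Suc i) *\<^sub>R G (p (Suc i))" for i
    define R where "R i = P i *\<^sub>R
      (\<gamma> (m + Suc i) *\<^sub>R (G (x (m + Suc i) \<omega>) - G (p (Suc i))) + \<rho> i)" for i
    define z where "z i = c i *\<^sub>R \<xi> (m + Suc i) \<omega>" for i
    have "norm (e N) \<le> exp (\<beta> * L * S\<^sup>2) * (\<epsilon> * (S\<^sup>2 + S) + \<eta> * (\<Sum>j<N. norm ((1 / P j) *\<^sub>R (\<Sum>i<j. z i))))"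
    proof (rule momentum_recursion_stability[where d = d and q = q and R = R])
      show "e 0 = 0" "d 0 = 0"
        using init \<omega> by (simp_all add: e_def d_def)
      show "e (Suc i) = e i + \<eta> *\<^sub>R d i + q i" for i
        using x_step[of "m + Suc i" \<omega>] \<omega> by (simp add: e_def d_def q_def algebra_simps)
      show "norm (q i) \<le> \<epsilon> * \<eta>" if "i < N" for i
        using p[OF that] unfolding q_def norm_minus_cancel .
      show "P (Suc i) *\<^sub>R d (Suc i) = P i *\<^sub>R d i - R i - z i" for i
      proof -
        define k where "k = m + Suc i"
        define w where "w = v k \<omega>"
        define w' where "w' = v (m + i) \<omega>"
        define g where "g = G (x k \<omega>) + \<xi> k \<omega>"
        have k: "real k > 0" "P i = real k * (real k + 1)" "P (Suc i) = (real k + 1) * (real k + 2)"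
          "c i = P i * \<gamma> k"
          by (simp_all add: k_def P_def c_def)
        have scheme: "w + (2 / real k) *\<^sub>R w = w' - \<gamma> k *\<^sub>R g"
          using v_step[of k \<omega>] \<omega> by (simp add: k_def w_def w'_def g_def \<gamma>_def algebra_simps)
        have ref: "u (Suc i) + (2 / real k) *\<^sub>R u (Suc i) = u i - \<gamma> k *\<^sub>R G (p (Suc i)) + \<rho> i"
          by (simp add: \<rho>_def k_def algebra_simps)
        have "P (Suc i) = P i * (1 + 2 / real k)"
          using k(1) by (simp add: k(2,3) field_simps)
        then have "P (Suc i) *\<^sub>R d (Suc i)
            = P i *\<^sub>R ((w + (2 / real k) *\<^sub>R w) - (u (Suc i) + (2 / real k) *\<^sub>R u (Suc i)))"
          by (simp add: d_def w_def k_def scaleR_diff_right scaleR_add_right scaleR_add_left algebra_simps)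
        also have "\<dots> = P i *\<^sub>R d i - R i - z i"
          unfolding scheme ref
          by (simp add: d_def w'_def R_def z_def k(4) g_def k_def algebra_simps)
        finally show ?thesis .
      qed
      show "norm (R i) \<le> P (Suc i) * (\<beta> * L * \<eta> * norm (e (Suc i)) + \<epsilon> * \<eta>)" if i: "i < N" for i
      proof -
        have "norm (\<gamma> (m + Suc i) *\<^sub>R (G (x (m + Suc i) \<omega>) - G (p (Suc i)))) \<le> (\<beta> * \<eta>) * (L * norm (e (Suc i)))"
          using \<beta>[folded \<gamma>_def, of "m + Suc i"] i \<gamma>0[of "m + Suc i"] lip nonneg \<eta>
          by (auto simp: e_def intro!: mult_mono)
        moreover have "norm (\<rho> i) \<le> \<epsilon> * \<eta>"
          using u[OF i refl] by (simp add: \<rho>_def \<gamma>_def)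
        ultimately have "norm (\<gamma> (m + Suc i) *\<^sub>R (G (x (m + Suc i) \<omega>) - G (p (Suc i))) + \<rho> i)
            \<le> (\<beta> * \<eta>) * (L * norm (e (Suc i))) + \<epsilon> * \<eta>"
          by (rule norm_triangle_mono)
        then have "P i * norm (\<gamma> (m + Suc i) *\<^sub>R (G (x (m + Suc i) \<omega>) - G (p (Suc i))) + \<rho> i)
            \<le> P i * ((\<beta> * \<eta>) * (L * norm (e (Suc i))) + \<epsilon> * \<eta>)"
          using P(1)[of i] by (intro mult_left_mono) auto
        then have "norm (R i) \<le> P i * (\<beta> * L * \<eta> * norm (e (Suc i)) + \<epsilon> * \<eta>)"
          using P(1)[of i] by (simp add: R_def mult_ac)
        also have "\<dots> \<le> P (Suc i) * (\<beta> * L * \<eta> * norm (e (Suc i)) + \<epsilon> * \<eta>)"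
          using monoD[OF P(2), of i "Suc i"] nonneg \<eta> by (intro mult_right_mono) auto
        finally show ?thesis .
      qed
    qed (use \<eta> S nonneg P in auto)
    moreover have "(1 / P j) *\<^sub>R (\<Sum>i<j. z i) = n j \<omega>" for j
      by (simp add: n_def z_def scaleR_sum_right)
    ultimately have "norm (e N) \<le> exp (\<beta> * L * S\<^sup>2) * (\<epsilon> * (S\<^sup>2 + S) + A \<omega>)"
      by (simp add: A_def)
    also have "\<dots> \<le> exp (\<beta> * L * S\<^sup>2) * ((S\<^sup>2 + S + 1) * (\<epsilon> + A \<omega>))"
    proof (rule mult_left_mono)
      have "0 \<le> A \<omega>"
        using \<eta> by (simp add: A_def sum_nonneg)
      then have "0 \<le> (S\<^sup>2 + S) * A \<omega>"
        using S0 by simp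
      then show "\<epsilon> * (S\<^sup>2 + S) + A \<omega> \<le> (S\<^sup>2 + S + 1) * (\<epsilon> + A \<omega>)"
        using nonneg by (simp add: algebra_simps)
    qed simp
    finally show ?thesis
      by (simp add: e_def C mult.assoc)
  qed

  \<comment> \<open>The weights \<open>c i / P j\<close> are at most \<open>\<beta> * \<eta>\<close>, because \<open>P\<close> is increasing.\<close>
  have noise: "integrable M (\<lambda>\<omega>. (norm (n j \<omega>))\<^sup>2)"
    "expectation (\<lambda>\<omega>. (norm (n j \<omega>))\<^sup>2) \<le> CARD('n) * \<beta>\<^sup>2 * S * \<eta>" if j: "j < N" for j
  proof -
    define f where "f k = c (k - Suc m) / P j" for k
    have n_eq: "n j \<omega> = (\<Sum>k\<in>{m<..m + j}. f k *\<^sub>R \<xi> k \<omega>)" for \<omega>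
      unfolding n_def
      by (rule sum.reindex_bij_witness[of _ "\<lambda>k. k - Suc m" "\<lambda>i. m + Suc i"]) (auto simp: f_def)
    have sub: "{m<..m + j} \<subseteq> {m<..}"
      by auto
    note moments = second_moment_indep_vector_sum[OF finite_greaterThanAtMost indep_vars_subset[OF indep sub],
        where c = f, OF std_normal_vec_moments(2,1,3)[OF normal]]
    show "integrable M (\<lambda>\<omega>. (norm (n j \<omega>))\<^sup>2)"
      unfolding n_eq by (rule moments) auto
    have "expectation (\<lambda>\<omega>. (norm (n j \<omega>))\<^sup>2) = CARD('n) * (\<Sum>k\<in>{m<..m + j}. (f k)\<^sup>2)"
      unfolding n_eq by (rule moments) auto
    also have "\<dots> \<le> CARD('n) * (\<Sum>k\<in>{m<..m + j}. (\<beta> * \<eta>)\<^sup>2)"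
    proof (intro mult_left_mono sum_mono power_mono)
      fix k assume k: "k \<in> {m<..m + j}"
      have "f k = (P (k - Suc m) / P j) * \<gamma> k"
        using k by (simp add: f_def c_def P_def)
      also have "\<dots> \<le> 1 * (\<beta> * \<eta>)"
        using monoD[OF P(2), of "k - Suc m" j] k j P(1)[of j] P(1)[of "k - Suc m"] \<beta>[of k] \<gamma>0[of k]
        by (intro mult_mono) (auto simp: \<gamma>_def)
      finally show "f k \<le> \<beta> * \<eta>"
        by simp
      show "0 \<le> f k"
        using P(1)[of j] \<gamma>0 by (simp add: f_def c_def)
    qed simp_all
    also have "\<dots> = CARD('n) * \<beta>\<^sup>2 * (real j * \<eta>) * \<eta>"
      by (simp add: power2_eq_square)
    also have "\<dots> \<le> CARD('n) * \<beta>\<^sup>2 * S * \<eta>"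
    proof -
      have "real j * \<eta> \<le> real N * \<eta>"
        using j \<eta> by (intro mult_right_mono) auto
      then have "real j * \<eta> \<le> S"
        using S by linarith
      then show ?thesis
        using \<eta> by (intro mult_right_mono mult_left_mono) auto
    qed
    finally show "expectation (\<lambda>\<omega>. (norm (n j \<omega>))\<^sup>2) \<le> CARD('n) * \<beta>\<^sup>2 * S * \<eta>" .
  qed

  \<comment> \<open>An integrable bound for the squared error: Cauchy--Schwarz turns the square of the average of
    the noise norms into an average of their squares, so that second moments suffice.\<close>
  define U where "U \<omega> = 2 * C\<^sup>2 * (\<epsilon>\<^sup>2 + \<eta>\<^sup>2 * (real N * (\<Sum>j<N. (norm (n j \<omega>))\<^sup>2)))" for \<omega>
  have noise_sum: "integrable M (\<lambda>\<omega>. \<Sum>j<N. (norm (n j \<omega>))\<^sup>2)"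
    by (intro Bochner_Integration.integrable_sum noise(1)) simp
  have U: "integrable M U"
    unfolding U_def
    by (intro integrable_mult_right Bochner_Integration.integrable_add integrable_const noise_sum)
  have sq: "(norm (x (m + N) \<omega> - p N))\<^sup>2 \<le> U \<omega>" if "\<omega> \<in> space M" for \<omega>
  proof -
    have "(norm (x (m + N) \<omega> - p N))\<^sup>2 \<le> (C * (\<epsilon> + A \<omega>))\<^sup>2"
      by (rule power_mono[OF path[OF that]]) simp
    also have "\<dots> \<le> C\<^sup>2 * (2 * (\<epsilon>\<^sup>2 + (A \<omega>)\<^sup>2))"
      unfolding power_mult_distrib
      using sum_squares_bound[of \<epsilon> "A \<omega>"]
      by (intro mult_left_mono) (auto simp: power2_sum)
    also have "\<dots> \<le> C\<^sup>2 * (2 * (\<epsilon>\<^sup>2 + \<eta>\<^sup>2 * (real N * (\<Sum>j<N. (norm (n j \<omega>))\<^sup>2))))"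
      using sum_squared_le_sum_of_squares[of "\<lambda>j. norm (n j \<omega>)" "{..<N}"]
      by (intro mult_left_mono add_left_mono)
        (auto simp: A_def power_mult_distrib mult.commute intro!: mult_left_mono)
    finally show ?thesis
      by (simp only: U_def mult_ac)
  qed

  have G_meas: "G \<in> borel_measurable borel"
  proof (rule borel_measurable_continuous_onI)
    have "L-lipschitz_on UNIV G"
      using lip nonneg by (auto intro!: lipschitz_onI simp: dist_norm)
    then show "continuous_on UNIV G"
      by (rule lipschitz_on_continuous_on)
  qed
  \<comment> \<open>The iterates are measurable because the scheme can be solved explicitly: the new position depends
    on the old iterates only, and the implicit velocity enters linearly.\<close>
  have "random_variable borel (x (m + i)) \<and> random_variable borel (v (m + i))" for i
  proof (induction i)
    case 0
    have "random_variable borel (x m) \<longleftrightarrow> random_variable borel (\<lambda>_. p 0)"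
      "random_variable borel (v m) \<longleftrightarrow> random_variable borel (\<lambda>_. u 0)"
      by (intro measurable_cong; simp add: init)+
    then show ?case by simp
  next
    case (Suc i)
    define k where "k = m + Suc i"
    have [measurable]: "random_variable borel (\<xi> k)"
      using distributed_measurable[OF normal[of k]] by (simp add: k_def)
    note [measurable] = Suc.IH[THEN conjunct1] Suc.IH[THEN conjunct2] G_meas
    have "x k \<omega> = x (m + i) \<omega> + \<eta> *\<^sub>R v (m + i) \<omega>" if "\<omega> \<in> space M" for \<omega>
      using x_step[of k \<omega>] that by (simp add: k_def algebra_simps)
    then have "random_variable borel (x k) \<longleftrightarrow> random_variable borel (\<lambda>\<omega>. x (m + i) \<omega> + \<eta> *\<^sub>R v (m + i) \<omega>)"
      by (intro measurable_cong)
    then have [measurable]: "random_variable borel (x k)"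
      by simp
    have "v k \<omega> = (1 / (1 + 2 / real k)) *\<^sub>R (v (m + i) \<omega> - \<gamma> k *\<^sub>R (G (x k \<omega>) + \<xi> k \<omega>))"
      if "\<omega> \<in> space M" for \<omega>
    proof -
      have "v (m + i) \<omega> - \<gamma> k *\<^sub>R (G (x k \<omega>) + \<xi> k \<omega>) = (1 + 2 / real k) *\<^sub>R v k \<omega>"
        using v_step[of k \<omega>] that by (simp add: k_def \<gamma>_def algebra_simps)
      moreover have "1 + 2 / real k \<noteq> 0"
        by (simp add: k_def add_nonneg_eq_0_iff)
      ultimately show ?thesis
        by simp
    qed
    then have "random_variable borel (v k) \<longleftrightarrow> random_variable borel
        (\<lambda>\<omega>. (1 / (1 + 2 / real k)) *\<^sub>R (v (m + i) \<omega> - \<gamma> k *\<^sub>R (G (x k \<omega>) + \<xi> k \<omega>)))"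
      by (intro measurable_cong)
    then have "random_variable borel (v k)"
      by simp
    then show ?case
      using \<open>random_variable borel (x k)\<close> by (simp add: k_def)
  qed
  then show x_meas [measurable]: "random_variable borel (x (m + N))"
    by simp
  show int: "integrable M (\<lambda>\<omega>. (norm (x (m + N) \<omega> - p N))\<^sup>2)"
    by (rule Bochner_Integration.integrable_bound[OF U])
       (use sq in \<open>auto intro!: AE_I2 order_trans[OF sq abs_ge_self]\<close>)
  have "expectation (\<lambda>\<omega>. (norm (x (m + N) \<omega> - p N))\<^sup>2) \<le> expectation U"
    by (rule integral_mono[OF int U sq])
  also have "\<dots> = 2 * C\<^sup>2 * (\<epsilon>\<^sup>2 + \<eta>\<^sup>2 * (real N * (\<Sum>j<N. expectation (\<lambda>\<omega>. (norm (n j \<omega>))\<^sup>2))))"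
    unfolding U_def using noise_sum noise(1) by (simp add: prob_space)
  also have "\<dots> \<le> 2 * C\<^sup>2 * (\<epsilon>\<^sup>2 + \<eta>\<^sup>2 * (real N * (\<Sum>j<N. CARD('n) * \<beta>\<^sup>2 * S * \<eta>)))"
    using noise(2) by (intro mult_left_mono add_left_mono sum_mono) auto
  also have "\<dots> = 2 * C\<^sup>2 * (\<epsilon>\<^sup>2 + CARD('n) * \<beta>\<^sup>2 * S * \<eta> * (real N * \<eta>)\<^sup>2)"
    by (simp add: power2_eq_square mult_ac)
  also have "\<dots> \<le> 2 * C\<^sup>2 * (\<epsilon>\<^sup>2 + CARD('n) * \<beta>\<^sup>2 * S * \<eta> * S\<^sup>2)"
    using S S0 \<eta> by (intro mult_left_mono add_left_mono power_mono) auto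
  finally show "expectation (\<lambda>\<omega>. (norm (x (m + N) \<omega> - p N))\<^sup>2)
      \<le> 2 * C\<^sup>2 * (\<epsilon>\<^sup>2 + CARD('n) * \<beta>\<^sup>2 * S ^ 3 * \<eta>)"
    by (simp add: power2_eq_square power3_eq_cube mult_ac)
qed

section \<open>Vanishing stepsize\<close>

lemma floor_grid:
  fixes a \<eta> :: real
  assumes "0 < \<eta>" and "0 \<le> a"
  shows "real (nat \<lfloor>a / \<eta>\<rfloor>) * \<eta> \<le> a" and "a < (real (nat \<lfloor>a / \<eta>\<rfloor>) + 1) * \<eta>"
proof -
  have "0 \<le> \<lfloor>a / \<eta>\<rfloor>"
    using assms by simp
  then have "real (nat \<lfloor>a / \<eta>\<rfloor>) \<le> a / \<eta>" "a / \<eta> < real (nat \<lfloor>a / \<eta>\<rfloor>) + 1"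
    by linarith+
  then show "real (nat \<lfloor>a / \<eta>\<rfloor>) * \<eta> \<le> a" "a < (real (nat \<lfloor>a / \<eta>\<rfloor>) + 1) * \<eta>"
    using assms(1) by (simp_all add: field_simps)
qed

lemma tendsto_0_of_quadratic_bound:
  fixes h :: "real \<Rightarrow> real"
  assumes "0 < a" "0 \<le> b"
    and nonneg: "\<And>\<eta>. 0 \<le> h \<eta>"
    and bound: "\<And>\<epsilon>. 0 < \<epsilon> \<Longrightarrow> \<forall>\<^sub>F \<eta> in at_right 0. h \<eta> \<le> a * \<epsilon>\<^sup>2 + b * \<eta>"
  shows "(h \<longlongrightarrow> 0) (at_right 0)"
proof (rule tendstoI)
  fix r :: real assume r: "0 < r"
  define \<epsilon> where "\<epsilon> = sqrt (r / (2 * a))"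
  have \<epsilon>: "0 < \<epsilon>" "a * \<epsilon>\<^sup>2 = r / 2"
    using r assms(1) by (auto simp: \<epsilon>_def)
  have "((\<lambda>\<eta>. b * \<eta>) \<longlongrightarrow> b * 0) (at_right 0)"
    by (intro tendsto_intros)
  then have "\<forall>\<^sub>F \<eta> in at_right 0. b * \<eta> < r / 2"
    by (rule order_tendstoD) (use r in simp)
  then show "\<forall>\<^sub>F \<eta> in at_right 0. dist (h \<eta>) 0 < r"
    using bound[OF \<epsilon>(1)]
  proof eventually_elim
    case (elim \<eta>)
    then show ?case
      using nonneg[of \<eta>] \<epsilon>(2) by (simp add: dist_real_def)
  qed
qed

theorem theorem1:
  fixes f :: "real ^ 'n \<Rightarrow> real"
    and L T0 T :: real
    and X V :: "real \<Rightarrow> real ^ 'n"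
    and M :: "'w measure"
    and \<xi> x v :: "real \<Rightarrow> nat \<Rightarrow> 'w \<Rightarrow> real ^ 'n"
  assumes smooth: "L_smooth L f"
    and T0: "T0 > 0"
    and ode_X: "\<And>t. t \<ge> T0 \<Longrightarrow> (X has_vector_derivative V t) (at t within {T0..})"
    and ode_V: "\<And>t. t \<ge> T0 \<Longrightarrow>
          (V has_vector_derivative
             (- (2 / t) *\<^sub>R V t - (2 / t powr (3/2)) *\<^sub>R gradient f (X t))) (at t within {T0..})"
    and prob: "prob_space M"
    and noise_indep: "\<And>\<eta>. \<eta> > 0 \<Longrightarrow> nat \<lfloor>T0 / \<eta>\<rfloor> \<ge> 1 \<Longrightarrow>
          prob_space.indep_vars M (\<lambda>_. borel) (\<xi> \<eta>) {nat \<lfloor>T0 / \<eta>\<rfloor> <..}"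
    and noise_normal: "\<And>\<eta> k. \<eta> > 0 \<Longrightarrow> nat \<lfloor>T0 / \<eta>\<rfloor> \<ge> 1 \<Longrightarrow> k > nat \<lfloor>T0 / \<eta>\<rfloor> \<Longrightarrow>
          distributed M lborel (\<xi> \<eta> k) (\<lambda>y. ennreal (std_normal_density_vec y))"
    and x_init: "\<And>\<eta> \<omega>. \<eta> > 0 \<Longrightarrow> nat \<lfloor>T0 / \<eta>\<rfloor> \<ge> 1 \<Longrightarrow> \<omega> \<in> space M \<Longrightarrow>
          x \<eta> (nat \<lfloor>T0 / \<eta>\<rfloor>) \<omega> = X T0"
    and v_init: "\<And>\<eta> \<omega>. \<eta> > 0 \<Longrightarrow> nat \<lfloor>T0 / \<eta>\<rfloor> \<ge> 1 \<Longrightarrow> \<omega> \<in> space M \<Longrightarrow>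
          v \<eta> (nat \<lfloor>T0 / \<eta>\<rfloor>) \<omega> = V T0"
    and x_step: "\<And>\<eta> k \<omega>. \<eta> > 0 \<Longrightarrow> nat \<lfloor>T0 / \<eta>\<rfloor> \<ge> 1 \<Longrightarrow> k > nat \<lfloor>T0 / \<eta>\<rfloor> \<Longrightarrow>
          \<omega> \<in> space M \<Longrightarrow>
          x \<eta> k \<omega> - x \<eta> (k - 1) \<omega> = \<eta> *\<^sub>R v \<eta> (k - 1) \<omega>"
    and v_step: "\<And>\<eta> k \<omega>. \<eta> > 0 \<Longrightarrow> nat \<lfloor>T0 / \<eta>\<rfloor> \<ge> 1 \<Longrightarrow> k > nat \<lfloor>T0 / \<eta>\<rfloor> \<Longrightarrow>
          \<omega> \<in> space M \<Longrightarrow>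
          v \<eta> k \<omega> - v \<eta> (k - 1) \<omega> =
            - (2 / real k) *\<^sub>R v \<eta> k \<omega>
            - (2 / real k * (1 / sqrt (real k * \<eta>))) *\<^sub>R (gradient f (x \<eta> k \<omega>) + \<xi> \<eta> k \<omega>)"
    and T: "T > T0"
  shows "(\<forall>\<^sub>F \<eta> in at_right 0.
            integrable M (\<lambda>\<omega>. (norm (x \<eta> (nat \<lfloor>T / \<eta>\<rfloor>) \<omega> - X T))\<^sup>2)) \<and>
         ((\<lambda>\<eta>. prob_space.expectation M
            (\<lambda>\<omega>. (norm (x \<eta> (nat \<lfloor>T / \<eta>\<rfloor>) \<omega> - X T))\<^sup>2)) \<longlongrightarrow> 0) (at_right 0)"
proof -
  interpret prob_space M by (rule prob)
  have lip: "norm (gradient f y - gradient f z) \<le> \<bar>L\<bar> * norm (y - z)" for y z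
  proof -
    have "norm (gradient f y - gradient f z) \<le> L * norm (y - z)"
      using smooth by (auto simp: L_smooth_def)
    also have "\<dots> \<le> \<bar>L\<bar> * norm (y - z)"
      by (intro mult_right_mono) auto
    finally show ?thesis .
  qed
  have "\<bar>L\<bar>-lipschitz_on UNIV (gradient f)"
    using lip by (auto intro!: lipschitz_onI simp: dist_norm)
  then have grad_cont: "continuous_on UNIV (gradient f)"
    by (rule lipschitz_on_continuous_on)
  \<comment> \<open>The grid times after the start exceed \<open>T0\<close>, so \<open>\<beta>\<close> bounds the coefficient
    $2 t^{-3/2}$ along the whole run.  The constants \<open>\<beta>\<close>, \<open>C\<close> and \<open>D\<close> do not depend on
    \<open>\<eta>\<close> and \<open>\<epsilon>\<close>.\<close>
  define \<beta> where "\<beta> = 2 / T0 powr (3/2)"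
  define C where "C = exp (\<beta> * \<bar>L\<bar> * T\<^sup>2) * (T\<^sup>2 + T + 1)"
  define D where "D = real CARD('n) * \<beta>\<^sup>2 * T ^ 3"
  have \<beta>0: "0 \<le> \<beta>" and D0: "0 \<le> D"
    using T0 T by (auto simp: \<beta>_def D_def)
  let ?err = "\<lambda>\<eta> \<omega>. (norm (x \<eta> (nat \<lfloor>T / \<eta>\<rfloor>) \<omega> - X T))\<^sup>2"
  have key: "\<forall>\<^sub>F \<eta> in at_right 0. integrable M (?err \<eta>) \<and>
      expectation (?err \<eta>) \<le> (4 * C\<^sup>2 + 2) * \<epsilon>\<^sup>2 + 4 * C\<^sup>2 * D * \<eta>" if \<epsilon>: "0 < \<epsilon>" for \<epsilon>
  proof -
    obtain \<delta>1 where \<delta>1: "0 < \<delta>1"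
      "\<And>\<eta> s t. 0 < \<eta> \<Longrightarrow> \<eta> < \<delta>1 \<Longrightarrow> T0 \<le> s \<Longrightarrow> s + \<eta> \<le> T + T0 \<Longrightarrow> T0 \<le> t \<Longrightarrow> t \<le> T + T0 \<Longrightarrow>
        \<bar>s + \<eta> - t\<bar> \<le> \<eta> \<Longrightarrow>
        norm (X (s + \<eta>) - X s - \<eta> *\<^sub>R V s) \<le> \<epsilon> * \<eta> \<and>
        norm (V (s + \<eta>) - V s + (\<eta> * (2 / t)) *\<^sub>R V (s + \<eta>)
          + (\<eta> * (2 / t powr (3/2))) *\<^sub>R gradient f (X (s + \<eta>))) \<le> \<epsilon> * \<eta>"
      using momentum_ode_consistency[OF T0 \<epsilon> grad_cont ode_X ode_V, where B = "T + T0"] by blast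
    have "continuous_on {T0..} X"
      using ode_X by (auto intro!: continuous_on_vector_derivative)
    then obtain \<delta>2 where \<delta>2: "0 < \<delta>2" "\<And>s. T0 \<le> s \<Longrightarrow> dist s T < \<delta>2 \<Longrightarrow> dist (X s) (X T) < \<epsilon>"
      using T \<epsilon> unfolding continuous_on_iff by (metis atLeast_iff less_imp_le)
    have "\<forall>\<^sub>F \<eta> in at_right 0. \<eta> \<in> {0<..<Min {\<delta>1, \<delta>2, T0}}"
      using \<delta>1(1) \<delta>2(1) T0 by (intro eventually_at_right_real) simp
    then show ?thesis
    proof eventually_elim
      case (elim \<eta>)
      then have \<eta>: "0 < \<eta>" "\<eta> < \<delta>1" "\<eta> < \<delta>2" "\<eta> < T0"
        by auto
      define m where "m = nat \<lfloor>T0 / \<eta>\<rfloor>"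
      define K where "K = nat \<lfloor>T / \<eta>\<rfloor>"
      define N where "N = K - m"
      \<comment> \<open>The times at which the solution is compared with the iterates.  They start exactly at
        \<open>T0\<close>, where the solution is defined and the initial values agree, and are ahead of the
        grid times of the scheme by \<open>T0 - m * \<eta>\<close>, which lies between \<open>0\<close> and \<open>\<eta>\<close>.\<close>
      define s where "s i = T0 + real i * \<eta>" for i
      have m: "real m * \<eta> \<le> T0" "T0 < (real m + 1) * \<eta>"
        using floor_grid[OF \<eta>(1), of T0] T0 by (simp_all add: m_def)
      have K: "real K * \<eta> \<le> T" "T < (real K + 1) * \<eta>"
        using floor_grid[OF \<eta>(1), of T] T0 T by (simp_all add: K_def)
      have m1: "1 \<le> nat \<lfloor>T0 / \<eta>\<rfloor>"
        using \<eta> by (simp add: le_nat_iff le_floor_iff field_simps)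
      have "m \<le> K"
        unfolding m_def K_def using \<eta> T by (intro nat_mono floor_mono divide_right_mono) auto
      then have mN: "m + N = K"
        by (simp add: N_def)
      have NT: "real N * \<eta> \<le> T"
      proof -
        have "real N * \<eta> \<le> real K * \<eta>"
          using \<eta> by (intro mult_right_mono) (auto simp: N_def)
        then show ?thesis
          using K by linarith
      qed
      have coeff: "2 / real k = \<eta> * (2 / (real k * \<eta>))"
        "2 / real k * (1 / sqrt (real k * \<eta>)) = \<eta> * (2 / (real k * \<eta>) powr (3/2))" if "0 < k" for k
      proof -
        have t: "0 < real k * \<eta>"
          using that \<eta> by simp
        have "(real k * \<eta>) powr (3/2) = (real k * \<eta>) powr (1 + 1/2)"
          by simp
        also have "\<dots> = real k * \<eta> * sqrt (real k * \<eta>)"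
          unfolding powr_add using t by (simp add: powr_half_sqrt)
        finally show "2 / real k * (1 / sqrt (real k * \<eta>)) = \<eta> * (2 / (real k * \<eta>) powr (3/2))"
          using \<eta> that by (simp add: field_simps)
        show "2 / real k = \<eta> * (2 / (real k * \<eta>))"
          using \<eta> that by simp
      qed
      have times: "T0 \<le> real k * \<eta>" "real k * \<eta> \<le> T" if "m < k" "k \<le> m + N" for k
      proof -
        have "(real m + 1) * \<eta> \<le> real k * \<eta>" "real k * \<eta> \<le> real K * \<eta>"
          using that \<eta> mN by (auto intro!: mult_right_mono)
        then show "T0 \<le> real k * \<eta>" "real k * \<eta> \<le> T"
          using m K by linarith+
      qed
      have consistent: "norm (X (s (Suc i)) - X (s i) - \<eta> *\<^sub>R V (s i)) \<le> \<epsilon> * \<eta> \<and>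
          norm (V (s (Suc i)) - V (s i) + (2 / real k) *\<^sub>R V (s (Suc i))
            + (2 / real k * (1 / sqrt (real k * \<eta>))) *\<^sub>R gradient f (X (s (Suc i)))) \<le> \<epsilon> * \<eta>"
        if "i < N" and k: "k = m + Suc i" for i k
      proof -
        have t: "T0 \<le> real k * \<eta>" "real k * \<eta> \<le> T"
          using that by (auto intro!: times simp del: of_nat_add of_nat_Suc)
        have suc: "s (Suc i) = s i + \<eta>"
          by (simp add: s_def algebra_simps)
        have "s i + \<eta> - real k * \<eta> = T0 - real m * \<eta>"
          by (simp add: s_def k algebra_simps)
        then have shift: "0 \<le> s i + \<eta> - real k * \<eta>" "s i + \<eta> - real k * \<eta> \<le> \<eta>"
          using m by (auto simp: algebra_simps)
        have "0 < k"
          by (simp add: k)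
        show ?thesis
          unfolding suc coeff(2)[OF \<open>0 < k\<close>] unfolding coeff(1)[OF \<open>0 < k\<close>]
          by (rule \<delta>1(2)) (use \<eta> t shift T0 in \<open>auto simp: s_def\<close>)
      qed
      have coeff_bound: "2 / real k * (1 / sqrt (real k * \<eta>)) \<le> \<beta> * \<eta>" if "m < k" "k \<le> m + N" for k
      proof -
        have "2 / (real k * \<eta>) powr (3/2) \<le> \<beta>"
          unfolding \<beta>_def using times[OF that] T0 by (intro frac_le powr_mono2) auto
        then have "\<eta> * (2 / (real k * \<eta>) powr (3/2)) \<le> \<eta> * \<beta>"
          using \<eta> by (intro mult_left_mono) auto
        then show ?thesis
          using coeff(2)[of k] that by (simp only: mult.commute[of \<beta>])
      qed
      have init: "x \<eta> m \<omega> = X (s 0)" "v \<eta> m \<omega> = V (s 0)" if "\<omega> \<in> space M" for \<omega>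
        using x_init[OF \<eta>(1) m1 that] v_init[OF \<eta>(1) m1 that] by (simp_all add: m_def s_def)
      have error: "random_variable borel (x \<eta> (m + N))"
        "integrable M (\<lambda>\<omega>. (norm (x \<eta> (m + N) \<omega> - X (s N)))\<^sup>2)"
        "expectation (\<lambda>\<omega>. (norm (x \<eta> (m + N) \<omega> - X (s N)))\<^sup>2) \<le> 2 * C\<^sup>2 * (\<epsilon>\<^sup>2 + CARD('n) * \<beta>\<^sup>2 * T ^ 3 * \<eta>)"
        by (rule sgdm_mean_square_error[where x = "x \<eta>" and v = "v \<eta>" and \<xi> = "\<xi> \<eta>" and p = "\<lambda>i. X (s i)"
            and u = "\<lambda>i. V (s i)",
            OF \<eta>(1) NT less_imp_le[OF \<epsilon>] abs_ge_zero \<beta>0 lip noise_indep[OF \<eta>(1) m1, folded m_def]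
              noise_normal[OF \<eta>(1) m1, folded m_def] init
              x_step[OF \<eta>(1) m1, folded m_def] v_step[OF \<eta>(1) m1, folded m_def] coeff_bound
              consistent[OF _ refl, THEN conjunct1] consistent[THEN conjunct2] C_def];
            assumption)+
      let ?num = "\<lambda>\<omega>. (norm (x \<eta> (m + N) \<omega> - X (s N)))\<^sup>2"
      \<comment> \<open>The comparison ends at \<open>s N\<close> instead of \<open>T\<close>; both ends are rounded by less than
        one step, hence the two times differ by less than \<open>\<eta>\<close>.\<close>
      have "real N * \<eta> = (real K - real m) * \<eta>"
        using \<open>m \<le> K\<close> by (simp add: N_def of_nat_diff)
      then have "s N - T = (T0 - real m * \<eta>) - (T - real K * \<eta>)"
        by (simp add: s_def algebra_simps)
      then have "dist (s N) T < \<delta>2"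
        using m K \<eta> by (auto simp: dist_real_def algebra_simps)
      then have endpoint: "norm (X (s N) - X T) \<le> \<epsilon>"
        using \<delta>2(2)[of "s N"] \<eta> by (simp add: dist_norm s_def)
      have err_le: "?err \<eta> \<omega> \<le> 2 * ?num \<omega> + 2 * \<epsilon>\<^sup>2" for \<omega>
      proof -
        define a where "a = norm (x \<eta> (m + N) \<omega> - X (s N))"
        have "norm (x \<eta> (nat \<lfloor>T / \<eta>\<rfloor>) \<omega> - X T) \<le> a + \<epsilon>"
          using norm_triangle_mono[OF order_refl endpoint, of "x \<eta> (m + N) \<omega> - X (s N)"]
          by (simp add: mN a_def K_def)
        then have "?err \<eta> \<omega> \<le> (a + \<epsilon>)\<^sup>2"
          by (rule power_mono) simp
        also have "\<dots> \<le> 2 * a\<^sup>2 + 2 * \<epsilon>\<^sup>2"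
          using sum_squares_bound[of a \<epsilon>] by (simp add: power2_sum)
        finally show ?thesis
          by (simp add: a_def)
      qed
      have bound_int: "integrable M (\<lambda>\<omega>. 2 * ?num \<omega> + 2 * \<epsilon>\<^sup>2)"
        using error(2) by simp
      have [measurable]: "random_variable borel (x \<eta> (nat \<lfloor>T / \<eta>\<rfloor>))"
        using error(1) by (simp add: mN K_def)
      have int: "integrable M (?err \<eta>)"
        by (rule Bochner_Integration.integrable_bound[OF bound_int])
           (auto intro!: AE_I2 err_le)
      moreover have "expectation (?err \<eta>) \<le> (4 * C\<^sup>2 + 2) * \<epsilon>\<^sup>2 + 4 * C\<^sup>2 * D * \<eta>"
      proof -
        have "expectation (?err \<eta>) \<le> expectation (\<lambda>\<omega>. 2 * ?num \<omega> + 2 * \<epsilon>\<^sup>2)"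
          by (rule integral_mono[OF int bound_int err_le])
        also have "\<dots> = 2 * expectation ?num + 2 * \<epsilon>\<^sup>2"
          using error(2) by (simp add: prob_space)
        also have "\<dots> \<le> 2 * (2 * C\<^sup>2 * (\<epsilon>\<^sup>2 + D * \<eta>)) + 2 * \<epsilon>\<^sup>2"
          using error(3) by (simp add: D_def)
        finally show ?thesis
          by (simp add: algebra_simps)
      qed
      ultimately show ?case ..
    qed
  qed
  show ?thesis
  proof
    show "\<forall>\<^sub>F \<eta> in at_right 0. integrable M (?err \<eta>)"
      using key[of 1] by (auto elim: eventually_mono)
    show "((\<lambda>\<eta>. expectation (?err \<eta>)) \<longlongrightarrow> 0) (at_right 0)"
    proof (rule tendsto_0_of_quadratic_bound[where a = "4 * C\<^sup>2 + 2" and b = "4 * C\<^sup>2 * D"])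
      fix \<epsilon> :: real assume "0 < \<epsilon>"
      from key[OF this] show "\<forall>\<^sub>F \<eta> in at_right 0.
          expectation (?err \<eta>) \<le> (4 * C\<^sup>2 + 2) * \<epsilon>\<^sup>2 + 4 * C\<^sup>2 * D * \<eta>"
        by (auto elim: eventually_mono)
    qed (use D0 in \<open>auto simp: add_nonneg_pos\<close>)
  qed
qed

end
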